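(* Let $m_1 < m_2 < m_3 < \cdots$ be the Markov numbers listed in increasing order without repetition, let $L_n = \sqrt{9 - \frac{4}{m_n^2}}$ be the $n$th Lagrange number, and let $\varphi = \frac{1+\sqrt{5}}{2}$ be the golden ratio. The Markov Uniqueness Conjecture holds if and only if $$\sum_{n=1}^\infty (3 - L_n) = 4 - \varphi - \sqrt{2}.$$
   Context: A Markov triple is a solution $(x,y,z) \in \mathbb{Z}^3$ of $x^2+y^2+z^2 = 3xyz$. The Markov numbers are the positive integers that appear in a Markov triple; listed in increasing order, each distinct value once, they are $m_1 = 1, m_2 = 2, m_3 = 5, m_4 = 13, \ldots$ (an infinite sequence). The Lagrange numbers are $L_n = \sqrt{9 - 4/m_n^2}$ for $n \geq 1$, so $L_1 = \sqrt{5}$, $L_2 = \sqrt{8}$, and so on. (They originate as the successive optimal constants in Diophantine approximation; by a theorem of Markov they are given by this formula, which can be taken as the definition.) The sequence $L_n$ increases to $3$ and the series $\sum_n (3-L_n)$ converges. The Markov Uniqueness Conjecture is the assertion: for every Markov number $m$, the Markov triple $(x,y,m)$ with $0 < x \leq y \leq m$ (which always exists) is unique. *)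

theory Defs
  imports "HOL-Analysis.Analysis" "HOL-Library.Infinite_Set"
begin

definition markov_triple :: "int \<Rightarrow> int \<Rightarrow> int \<Rightarrow> bool" where
  "markov_triple x y z \<longleftrightarrow> x\<^sup>2 + y\<^sup>2 + z\<^sup>2 = 3 * x * y * z"

(* A set of naturals, because enumerate needs a well-ordered type. *)
definition markov_numbers :: "nat set" where
  "markov_numbers = {m. 0 < m \<and> (\<exists>x y z. markov_triple x y z \<and> int m \<in> {x, y, z})}"

(* Infinitude is what makes enumerate list exactly the Markov numbers, in strictly
   increasing order. The triples (1, a, b) with a < b give it. *)
lemma infinite_markov_numbers: "infinite markov_numbers"
proof -
  have chain: "\<exists>a b. n < a \<and> a < b \<and> markov_triple 1 (int a) (int b)" for n :: nat
  proof (induction n)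
    case 0
    have "markov_triple 1 (int 1) (int 2)"
      by (simp add: markov_triple_def)
    moreover have "0 < (1::nat)" "(1::nat) < 2" by simp_all
    ultimately show ?case by blast
  next
    case (Suc n)
    then obtain a b where ab: "n < a" "a < b" "markov_triple 1 (int a) (int b)"
      by blast
    have "int (3 * b - a) = 3 * int b - int a"
      using ab(2) by simp
    then have "markov_triple 1 (int b) (int (3 * b - a))"
      using ab(3) by (simp add: markov_triple_def power2_eq_square algebra_simps)
    moreover have "Suc n < b" "b < 3 * b - a"
      using ab(1,2) by simp_all
    ultimately show ?case by blast
  qed
  have "\<exists>m>n. m \<in> markov_numbers" for n
  proof -
    obtain a b where "n < a" "markov_triple 1 (int a) (int b)"
      using chain by blast
    then have "a \<in> markov_numbers"
      unfolding markov_numbers_def by force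
    with \<open>n < a\<close> show ?thesis by blast
  qed
  then show ?thesis
    by (simp add: infinite_nat_iff_unbounded)
qed

(* Indexed from 1; enumerate indexes from 0. The value at 0 is irrelevant. *)
definition markov_number :: "nat \<Rightarrow> nat" where
  "markov_number n = enumerate markov_numbers (n - 1)"

definition lagrange_number :: "nat \<Rightarrow> real" where
  "lagrange_number n = sqrt (9 - 4 / (real (markov_number n))\<^sup>2)"

definition markov_uniqueness_conjecture :: bool where
  "markov_uniqueness_conjecture \<longleftrightarrow>
     (\<forall>m\<in>markov_numbers.
        \<exists>!(x, y). 0 < x \<and> x \<le> y \<and> y \<le> int m \<and> markov_triple x y (int m))"

definition golden_ratio :: real where
  "golden_ratio = (1 + sqrt 5) / 2"

end

theory Submission
  imports Defs
begin

text \<open>Sum the gap \<open>3 - sqrt (9 - 4 / m\<^sup>2)\<close> over all sorted Markov triples \<open>x \<le> y \<le> m\<close>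
instead of over the Markov numbers. The result, \<open>4 - \<phi> - \<surd>2\<close>, is independent of the uniqueness
conjecture: it is McShane's identity for the modular torus. Every Markov number is the greatest
entry of at least one sorted triple, and all gaps are positive. So the sum over the Markov
numbers has the same value exactly when no Markov number is hit twice, which is the conjecture
(\<open>markov_uniqueness_conjecture_iff_inj\<close>, \<open>inj_on_iff_has_sum_image\<close>).

The value of the sum over triples comes from a telescoping argument in the style of Bowditch.
Apart from \<open>(1, 1, 1)\<close> and \<open>(1, 1, 2)\<close>, the triples form a binary tree with root \<open>(1, 2, 5)\<close>, in
which a child keeps the greatest entry and one of the two others. Give a triple \<open>(x, y, z)\<close> the
weight \<open>W = 6 - 2 z / (x y)\<close>. Dividing the Markov equation by \<open>x y z\<close> shows that the weight of a
triple is the sum of the weights of its children (\<open>weight_children\<close>), so every level of the tree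
has total weight 1. Put \<open>excess = (W - gap x - gap y) / 2\<close>. Since \<open>z\<close> occurs in both children and
\<open>x\<close>, \<open>y\<close> in one each, the excess of a triple is \<open>gap z\<close> plus the excesses of its children
(\<open>excess_children\<close>). Hence the gaps above level \<open>n\<close> add up to the excess of the root minus the
total excess of level \<open>n\<close>.

The remainder vanishes because \<open>W\<close>, \<open>gap x\<close> and \<open>gap y\<close> are the smaller roots of \<open>r (6 - r) = 4 t\<close>
for \<open>t = 1/x\<^sup>2 + 1/y\<^sup>2\<close>, \<open>1/x\<^sup>2\<close> and \<open>1/y\<^sup>2\<close>. The root is a convex function of \<open>t\<close>, linear to first
order and zero at zero, so the excess is nonnegative and small compared with the weight: it is at most \<open>W / y\<close> (\<open>excess_bounds\<close>), and
\<open>y\<close> exceeds the depth.\<close>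

section \<open>The tree of Markov triples\<close>

definition sorted_markov_triples :: "(int \<times> int \<times> int) set" where
  "sorted_markov_triples = {(x, y, z). 0 < x \<and> x \<le> y \<and> y \<le> z \<and> markov_triple x y z}"

definition nonsingular_triples :: "(int \<times> int \<times> int) set" where
  "nonsingular_triples = {(x, y, z). 0 < x \<and> x < y \<and> y < z \<and> markov_triple x y z}"

fun child :: "bool \<Rightarrow> int \<times> int \<times> int \<Rightarrow> int \<times> int \<times> int" where
  "child False (x, y, z) = (x, z, 3 * x * z - y)"
| "child True (x, y, z) = (y, z, 3 * y * z - x)"

primrec node :: "bool list \<Rightarrow> int \<times> int \<times> int" where
  "node [] = (1, 2, 5)"
| "node (b # w) = child b (node w)"

lemma markov_triple_vieta:
  "markov_triple x y z \<Longrightarrow> markov_triple x y (3 * x * y - z)"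
  by (simp add: markov_triple_def power2_eq_square algebra_simps)

lemma markov_triple_swap:
  "markov_triple x y z \<Longrightarrow> markov_triple y x z"
  "markov_triple x y z \<Longrightarrow> markov_triple x z y"
  by (simp_all add: markov_triple_def algebra_simps)

lemma child_nonsingular:
  assumes "t \<in> nonsingular_triples"
  shows "child b t \<in> nonsingular_triples"
proof -
  obtain x y z where t: "t = (x, y, z)" by (cases t)
  with assms have pos: "0 < x" "x < y" "y < z" and m: "markov_triple x y z"
    by (auto simp: nonsingular_triples_def)
  have "markov_triple x z (3 * x * z - y)" "markov_triple y z (3 * y * z - x)"
    using m by (blast intro: markov_triple_vieta markov_triple_swap)+
  moreover have "1 * z \<le> x * z" "1 * z \<le> y * z"
    using pos by (intro mult_right_mono; linarith)+
  then have "z < 3 * x * z - y" "z < 3 * y * z - x"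
    using pos by linarith+
  ultimately show ?thesis
    using pos by (cases b) (auto simp: t nonsingular_triples_def)
qed

lemma node_nonsingular: "node w \<in> nonsingular_triples"
  by (induction w)
    (simp_all add: child_nonsingular, simp add: nonsingular_triples_def markov_triple_def)

text \<open>\<open>parent\<close> and \<open>branch\<close> recover from a child the triple and the direction it came from. The entry
that the child dropped is the second root \<open>3 x y - z\<close> of the Markov equation in its last
variable, and its position relative to \<open>x\<close> tells the direction. This makes words in the tree
unique names of triples (\<open>inj_node\<close>).\<close>

fun parent :: "int \<times> int \<times> int \<Rightarrow> int \<times> int \<times> int" where
  "parent (x, y, z) = (let p = 3 * x * y - z in if x < p then (x, p, y) else (p, x, y))"

fun branch :: "int \<times> int \<times> int \<Rightarrow> bool" where
  "branch (x, y, z) \<longleftrightarrow> \<not> x < 3 * x * y - z"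

lemma parent_branch_child:
  assumes "t \<in> nonsingular_triples"
  shows "parent (child b t) = t" "branch (child b t) = b"
proof -
  obtain x y z where t: "t = (x, y, z)" by (cases t)
  then have "x < y" using assms by (simp add: nonsingular_triples_def)
  then show "parent (child b t) = t" "branch (child b t) = b"
    unfolding t by (cases b; simp)+
qed

lemma child_ne_root:
  assumes "t \<in> nonsingular_triples"
  shows "child b t \<noteq> (1, 2, 5)"
proof
  assume "child b t = (1, 2, 5)"
  then have "t = parent (1, 2, 5)"
    using parent_branch_child(1)[OF assms, of b] by simp
  then show False using assms by (simp add: nonsingular_triples_def)
qed

lemma inj_node: "inj node"
proof (rule injI)
  fix v w show "node v = node w \<Longrightarrow> v = w"
  proof (induction v arbitrary: w)
    case Nil
    then show ?case
      using child_ne_root[OF node_nonsingular] by (cases w) (auto dest: sym)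
  next
    case (Cons b v)
    then obtain c u where w: "w = c # u"
      using child_ne_root[OF node_nonsingular] by (cases w) auto
    then have eq: "child b (node v) = child c (node u)" using Cons.prems by simp
    have "b = c"
      using arg_cong[OF eq, of branch] by (simp add: parent_branch_child[OF node_nonsingular])
    moreover have "node v = node u"
      using arg_cong[OF eq, of parent] by (simp add: parent_branch_child[OF node_nonsingular])
    ultimately show ?case using Cons.IH w by simp
  qed
qed

text \<open>The equation forces \<open>x\<close> to divide \<open>y\<close>, and then the quotient to divide 2. This is why only
\<open>(1, 1, 1)\<close> and \<open>(1, 1, 2)\<close> lie outside the tree, and why the descent can stop only at
\<open>(1, 2, 5)\<close>.\<close>

lemma markov_triple_repeated:
  assumes "markov_triple x x y" "0 < x" "0 < y"
  shows "x = 1 \<and> (y = 1 \<or> y = 2)"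
proof -
  have eq: "2 * x\<^sup>2 + y\<^sup>2 = 3 * x\<^sup>2 * y"
    using assms(1) by (simp add: markov_triple_def power2_eq_square algebra_simps)
  then have "y\<^sup>2 = x\<^sup>2 * (3 * y - 2)" by (simp add: algebra_simps)
  then have "x dvd y" by (metis dvd_triv_left pow_divides_pow_iff zero_less_numeral)
  then obtain k where k: "y = x * k" by (rule dvdE)
  have "x\<^sup>2 * (2 + k\<^sup>2) = x\<^sup>2 * (3 * x * k)"
    using eq unfolding k by (simp add: power2_eq_square algebra_simps)
  then have k2: "2 + k\<^sup>2 = 3 * x * k" using assms(2) by simp
  then have "2 = k * (3 * x - k)" by (simp add: power2_eq_square algebra_simps)
  then have "k dvd 2" by (metis dvd_triv_left)
  moreover have "0 < k" using assms(2,3) k by (simp add: zero_less_mult_iff)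
  ultimately have "k = 1 \<or> k = 2" using zdvd_imp_le[of k 2] by auto
  then show ?thesis using k2 k by auto
qed

text \<open>The quadratic \<open>(T - z) (T - (3 x y - z)) = T\<^sup>2 - 3 x y T + x\<^sup>2 + y\<^sup>2\<close> is negative at \<open>T = y\<close>, so \<open>y\<close>
lies strictly between its roots. Replacing the greatest entry by the other root therefore
makes \<open>y\<close> the greatest entry. The lemma also bounds the weight by 3 later on.\<close>

lemma nonsingular_neighbour_less:
  assumes "(x, y, z) \<in> nonsingular_triples"
  shows "3 * x * y - z < y"
proof -
  have pos: "0 < x" "x < y" "y < z" and m: "markov_triple x y z"
    using assms by (auto simp: nonsingular_triples_def)
  have "(y - (3 * x * y - z)) * (z - y) = 3 * (x * y\<^sup>2) - 2 * y\<^sup>2 - x\<^sup>2"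
    using m by (simp add: markov_triple_def power2_eq_square algebra_simps)
  moreover have "1 * y\<^sup>2 \<le> x * y\<^sup>2" using pos by (intro mult_right_mono) auto
  moreover have "x\<^sup>2 < y\<^sup>2" using pos by (intro power_strict_mono) auto
  ultimately have "0 < (y - (3 * x * y - z)) * (z - y)" by linarith
  then show ?thesis using pos by (simp add: zero_less_mult_iff)
qed

lemma nonsingular_descent:
  assumes "(x, y, z) \<in> nonsingular_triples" "(x, y, z) \<noteq> (1, 2, 5)"
  shows "\<exists>b p q. (p, q, y) \<in> nonsingular_triples \<and> (x, y, z) = child b (p, q, y)"
proof -
  have pos: "0 < x" "x < y" "y < z" and m: "markov_triple x y z"
    using assms(1) by (auto simp: nonsingular_triples_def)
  define p where "p = 3 * x * y - z"
  have mp: "markov_triple x y p" unfolding p_def by (rule markov_triple_vieta[OF m])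
  have "p * z = x\<^sup>2 + y\<^sup>2"
    using m by (simp add: p_def markov_triple_def power2_eq_square algebra_simps)
  moreover have "0 < x\<^sup>2 + y\<^sup>2" using pos by (simp add: add_pos_pos)
  ultimately have p0: "0 < p" using pos by (metis zero_less_mult_pos2 less_trans)
  have py: "p < y" using nonsingular_neighbour_less[OF assms(1)] by (simp add: p_def)
  \<comment> \<open>A repeated entry would mean that the parent is \<open>(1, 1, 2)\<close>, whose only child is the root.\<close>
  have "p \<noteq> x"
  proof
    assume "p = x"
    then have "markov_triple x x y" using mp markov_triple_swap by blast
    then have "x = 1" "y = 2" using markov_triple_repeated pos by force+
    then show False using \<open>p = x\<close> assms(2) p_def by simp
  qed
  then consider "x < p" | "p < x" by linarith
  then show ?thesis
  proof cases
    case 1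
    have "(x, p, y) \<in> nonsingular_triples"
      using 1 py pos markov_triple_swap(2)[OF mp] by (simp add: nonsingular_triples_def)
    moreover have "(x, y, z) = child False (x, p, y)" by (simp add: p_def)
    ultimately show ?thesis by blast
  next
    case 2
    have "(p, x, y) \<in> nonsingular_triples"
      using 2 p0 pos markov_triple_swap(1)[OF markov_triple_swap(2)[OF mp]]
      by (simp add: nonsingular_triples_def)
    moreover have "(x, y, z) = child True (p, x, y)" by (simp add: p_def)
    ultimately show ?thesis by blast
  qed
qed

lemma range_node: "range node = nonsingular_triples"
proof
  show "range node \<subseteq> nonsingular_triples" using node_nonsingular by blast
  have "(x, y, z) \<in> range node" if "(x, y, z) \<in> nonsingular_triples" for x y z
    using that
  proof (induction "nat z" arbitrary: x y z rule: less_induct)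
    case less
    show ?case
    proof (cases "(x, y, z) = (1, 2, 5)")
      case True
      then show ?thesis by (metis node.simps(1) rangeI)
    next
      case False
      then obtain b p q where t: "(p, q, y) \<in> nonsingular_triples" "(x, y, z) = child b (p, q, y)"
        using nonsingular_descent less.prems by blast
      have "nat y < nat z" using less.prems by (simp add: nonsingular_triples_def)
      then obtain w where "(p, q, y) = node w" using less.hyps t(1) by blast
      then have "(x, y, z) = node (b # w)" using t(2) by simp
      then show ?thesis by blast
    qed
  qed
  then show "nonsingular_triples \<subseteq> range node" by auto
qed

text \<open>A repeated entry at the top, \<open>y = z\<close>, gives \<open>x\<^sup>2 + 2 y\<^sup>2 = 3 x y\<^sup>2 \<ge> 3 y\<^sup>2\<close> and so all three entries
coincide; every singular triple thus repeats its smallest entry.\<close>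

lemma sorted_markov_triples_eq:
  "sorted_markov_triples = {(1, 1, 1), (1, 1, 2)} \<union> nonsingular_triples"
proof
  show "{(1, 1, 1), (1, 1, 2)} \<union> nonsingular_triples \<subseteq> sorted_markov_triples"
    by (auto simp: sorted_markov_triples_def nonsingular_triples_def markov_triple_def)
  have "(x, y, z) \<in> {(1, 1, 1), (1, 1, 2)} \<union> nonsingular_triples"
    if "(x, y, z) \<in> sorted_markov_triples" for x y z
  proof -
    have pos: "0 < x" "x \<le> y" "y \<le> z" and m: "markov_triple x y z"
      using that by (auto simp: sorted_markov_triples_def)
    have "x = y" if "y = z"
    proof -
      have "x\<^sup>2 + 2 * y\<^sup>2 = 3 * (x * y\<^sup>2)"
        using m that by (simp add: markov_triple_def power2_eq_square algebra_simps)
      moreover have "1 * y\<^sup>2 \<le> x * y\<^sup>2" using pos by (intro mult_right_mono) auto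
      ultimately have "y\<^sup>2 \<le> x\<^sup>2" by linarith
      then show ?thesis using pos by (simp add: abs_le_square_iff[symmetric])
    qed
    moreover have "x = 1 \<and> (z = 1 \<or> z = 2)" if "x = y"
      using markov_triple_repeated[of x z] m pos that by auto
    ultimately show ?thesis
      using pos m by (cases "x = y"; cases "y = z") (auto simp: nonsingular_triples_def)
  qed
  then show "sorted_markov_triples \<subseteq> {(1, 1, 1), (1, 1, 2)} \<union> nonsingular_triples" by auto
qed

section \<open>Markov numbers as maxima of triples\<close>

fun greatest :: "int \<times> int \<times> int \<Rightarrow> nat" where
  "greatest (x, y, z) = nat z"

text \<open>In a triple with a nonzero entry the sum of squares is positive, hence so is the product.
The signs then cancel in pairs, and absolute values may be taken.\<close>

lemma markov_number_in_sorted_triple: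
  assumes "m \<in> markov_numbers"
  obtains a b c where "(a, b, c) \<in> sorted_markov_triples" "int m \<in> {a, b, c}"
proof -
  obtain x y z where m: "0 < m" and t: "markov_triple x y z" and mem: "int m \<in> {x, y, z}"
    using assms by (auto simp: markov_numbers_def)
  have "0 < x\<^sup>2 + y\<^sup>2 + z\<^sup>2"
    using m mem by (auto simp: add_pos_nonneg add_nonneg_pos)
  moreover have "x\<^sup>2 + y\<^sup>2 + z\<^sup>2 = 3 * (x * y * z)"
    using t by (simp add: markov_triple_def)
  ultimately have prod: "0 < x * y * z" by linarith
  then have "\<bar>x\<bar> * \<bar>y\<bar> * \<bar>z\<bar> = x * y * z" by (simp flip: abs_mult)
  then have t': "markov_triple \<bar>x\<bar> \<bar>y\<bar> \<bar>z\<bar>"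
    using t by (simp add: markov_triple_def mult.assoc)
  have pos: "0 < \<bar>x\<bar>" "0 < \<bar>y\<bar>" "0 < \<bar>z\<bar>" using prod by auto
  have mem': "int m \<in> {\<bar>x\<bar>, \<bar>y\<bar>, \<bar>z\<bar>}" using mem by auto
  have "\<exists>a b c. (a, b, c) \<in> sorted_markov_triples \<and> {a, b, c} = {u, v, w}"
    if uvw: "markov_triple u v w" "0 < u" "0 < v" "0 < w" for u v w
  proof -
    note perms = uvw(1) markov_triple_swap[OF uvw(1)]
      markov_triple_swap(2)[OF markov_triple_swap(1)[OF uvw(1)]]
      markov_triple_swap(1)[OF markov_triple_swap(2)[OF uvw(1)]]
      markov_triple_swap(1)[OF markov_triple_swap(2)[OF markov_triple_swap(1)[OF uvw(1)]]]
    consider "u \<le> v" "v \<le> w" | "u \<le> w" "w \<le> v" | "v \<le> u" "u \<le> w" | "v \<le> w" "w \<le> u"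
      | "w \<le> u" "u \<le> v" | "w \<le> v" "v \<le> u"
      by linarith
    moreover have "\<exists>a b c. (a, b, c) \<in> sorted_markov_triples \<and> {a, b, c} = {u, v, w}"
      if "markov_triple p q r" "0 < p" "p \<le> q" "q \<le> r" "{p, q, r} = {u, v, w}" for p q r
      using that by (intro exI[of _ p] exI[of _ q] exI[of _ r]) (simp add: sorted_markov_triples_def)
    note this[of u v w] this[of u w v] this[of v u w] this[of v w u] this[of w u v] this[of w v u]
    ultimately show ?thesis
      using perms uvw(2-4) by cases (simp_all add: insert_commute)
  qed
  from this[OF t' pos] obtain a b c
    where "(a, b, c) \<in> sorted_markov_triples" "{a, b, c} = {\<bar>x\<bar>, \<bar>y\<bar>, \<bar>z\<bar>}" by blast
  then show thesis using that[of a b c] mem' by simp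
qed

text \<open>A number that occurs in a triple need not be its greatest entry. But a child inherits its
first two entries from its parent, so each entry was the greatest one at the ancestor where it
first appeared, or it is 1 or 2.\<close>

lemma node_entries_greatest:
  assumes "node w = (x, y, z)" "u \<in> {x, y, z}"
  shows "nat u \<in> greatest ` sorted_markov_triples"
  using assms
proof (induction w arbitrary: x y z u)
  case Nil
  have "\<exists>t \<in> sorted_markov_triples. greatest t = nat u"
  proof -
    have "(1, 1, 1) \<in> sorted_markov_triples" "(1, 1, 2) \<in> sorted_markov_triples"
      "(1, 2, 5) \<in> sorted_markov_triples"
      by (simp_all add: sorted_markov_triples_def markov_triple_def)
    moreover have "greatest (1, 1, 1) = 1" "greatest (1, 1, 2) = 2" "greatest (1, 2, 5) = 5"
      by simp_all
    moreover have "nat u = 1 \<or> nat u = 2 \<or> nat u = 5" using Nil by auto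
    ultimately show ?thesis by metis
  qed
  then show ?case by force
next
  case (Cons b w)
  obtain p q r where t: "node w = (p, q, r)" by (cases "node w")
  have "(x, y, z) \<in> sorted_markov_triples"
    using node_nonsingular[of "b # w"] Cons.prems(1) by (simp add: sorted_markov_triples_eq)
  from imageI[OF this, of greatest] have "nat z \<in> greatest ` sorted_markov_triples" by simp
  moreover have "x \<in> {p, q, r} \<and> y \<in> {p, q, r}"
    using Cons.prems(1) t by (cases b) auto
  ultimately show ?case using Cons.IH[OF t] Cons.prems(2) by auto
qed

lemma greatest_image: "greatest ` sorted_markov_triples = markov_numbers"
proof
  show "greatest ` sorted_markov_triples \<subseteq> markov_numbers"
    by (force simp: sorted_markov_triples_def markov_numbers_def)
  show "markov_numbers \<subseteq> greatest ` sorted_markov_triples"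
  proof
    fix m assume "m \<in> markov_numbers"
    then obtain a b c where abc: "(a, b, c) \<in> sorted_markov_triples" "int m \<in> {a, b, c}"
      by (rule markov_number_in_sorted_triple)
    have one: "1 \<in> greatest ` sorted_markov_triples" and two: "2 \<in> greatest ` sorted_markov_triples"
      by (force simp: sorted_markov_triples_eq)+
    consider "(a, b, c) = (1, 1, 1)" | "(a, b, c) = (1, 1, 2)" | w where "node w = (a, b, c)"
      using abc(1) unfolding sorted_markov_triples_eq range_node[symmetric] by auto
    then show "m \<in> greatest ` sorted_markov_triples"
    proof cases
      case 3
      from node_entries_greatest[OF this abc(2)] show ?thesis by simp
    qed (use abc(2) one two in auto)
  qed
qed

lemma markov_uniqueness_conjecture_iff_inj:
  "markov_uniqueness_conjecture \<longleftrightarrow> inj_on greatest sorted_markov_triples"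
proof
  assume muc: markov_uniqueness_conjecture
  show "inj_on greatest sorted_markov_triples"
  proof (rule inj_onI)
    fix s t
    assume s: "s \<in> sorted_markov_triples" and t: "t \<in> sorted_markov_triples"
      and eq: "greatest s = greatest t"
    have "greatest s \<in> markov_numbers" using s greatest_image by blast
    with muc have unique: "\<exists>!(x, y). 0 < x \<and> x \<le> y \<and> y \<le> int (greatest s)
        \<and> markov_triple x y (int (greatest s))"
      unfolding markov_uniqueness_conjecture_def by blast
    obtain a b c a' b' c' where st: "s = (a, b, c)" "t = (a', b', c')" by (cases s; cases t)
    have c: "c = int (greatest s)" "c' = int (greatest s)"
      using s t eq by (auto simp: st sorted_markov_triples_def)
    let ?P = "\<lambda>(x, y). 0 < x \<and> x \<le> y \<and> y \<le> int (greatest s)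
      \<and> markov_triple x y (int (greatest s))"
    have "?P (a, b)"
      using s unfolding c(1)[symmetric] st by (simp add: sorted_markov_triples_def)
    moreover have "?P (a', b')"
      using t unfolding c(2)[symmetric] unfolding st by (simp add: sorted_markov_triples_def)
    moreover obtain p where "\<And>q. ?P q \<Longrightarrow> q = p" using unique by (rule ex1E) blast
    ultimately have "(a, b) = p" "(a', b') = p" by blast+
    then have "(a, b) = (a', b')" by (rule trans[OF _ sym])
    then show "s = t" using c st by simp
  qed
next
  assume inj: "inj_on greatest sorted_markov_triples"
  show markov_uniqueness_conjecture
    unfolding markov_uniqueness_conjecture_def
  proof
    fix m assume "m \<in> markov_numbers"
    then have "m \<in> greatest ` sorted_markov_triples" by (simp add: greatest_image)
    then obtain t where t: "t \<in> sorted_markov_triples" "greatest t = m" by blast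
    obtain x y z where xyz: "t = (x, y, z)" by (cases t)
    then have z: "z = int m" using t by (auto simp: sorted_markov_triples_def)
    have P: "0 < x \<and> x \<le> y \<and> y \<le> int m \<and> markov_triple x y (int m)"
      using t(1) xyz z by (simp add: sorted_markov_triples_def)
    have uniq: "(u, v) = (x, y)"
      if "0 < u \<and> u \<le> v \<and> v \<le> int m \<and> markov_triple u v (int m)" for u v
      using inj_onD[OF inj, of "(u, v, int m)" t] that t xyz z
      by (auto simp: sorted_markov_triples_def)
    show "\<exists>!(x, y). 0 < x \<and> x \<le> y \<and> y \<le> int m \<and> markov_triple x y (int m)"
    proof (rule ex1I[of _ "(x, y)"])
      show "q = (x, y)"
        if "case q of (x, y) \<Rightarrow> 0 < x \<and> x \<le> y \<and> y \<le> int m \<and> markov_triple x y (int m)" for q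
        using that uniq[of "fst q" "snd q"] by (simp add: case_prod_beta)
    qed (use P in simp)
  qed
qed

section \<open>Summing the gaps over the tree\<close>

definition lagrange_gap :: "real \<Rightarrow> real" where
  "lagrange_gap m = 3 - sqrt (9 - 4 / m\<^sup>2)"

text \<open>The quadratic equation is what relates gaps to weights: the gap is the smaller root of
\<open>r (6 - r) = 4 / m\<^sup>2\<close>.\<close>

lemma lagrange_gap_bounds:
  assumes "1 \<le> m"
  shows "0 < lagrange_gap m" "lagrange_gap m \<le> 1"
    "lagrange_gap m * (6 - lagrange_gap m) = 4 / m\<^sup>2"
    "lagrange_gap m \<le> 1 / m\<^sup>2"
proof -
  define q where "q = 4 / m\<^sup>2"
  have "1 \<le> m\<^sup>2" using assms by simp
  then have q: "0 < q" "q \<le> 4" using assms by (simp_all add: q_def divide_simps)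
  have "sqrt (9 - q) < 3" using q by (intro real_less_lsqrt) auto
  then show pos: "0 < lagrange_gap m" by (simp add: lagrange_gap_def q_def)
  have "2 \<le> sqrt (9 - q)" using q by (intro real_le_rsqrt) auto
  then show le1: "lagrange_gap m \<le> 1" by (simp add: lagrange_gap_def q_def)
  have "(sqrt (9 - q))\<^sup>2 = 9 - q" using q by simp
  then show eq: "lagrange_gap m * (6 - lagrange_gap m) = 4 / m\<^sup>2"
    by (simp add: lagrange_gap_def q_def power2_eq_square algebra_simps)
  have "lagrange_gap m * 4 \<le> lagrange_gap m * (6 - lagrange_gap m)"
    using pos le1 by (intro mult_left_mono) auto
  then show "lagrange_gap m \<le> 1 / m\<^sup>2" unfolding eq by simp
qed

text \<open>In the normalisation \<open>X = 3x\<close>, \<open>Y = 3y\<close>, \<open>Z = 3z\<close>, where \<open>X\<^sup>2 + Y\<^sup>2 + Z\<^sup>2 = X Y Z\<close>, and with \<open>P = X Y - Z\<close>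
for the second root, the weight is \<open>6 P / (X Y)\<close>, six times the quantity that Bowditch attaches
to the suitably directed edge joining \<open>(X, Y, P)\<close> and \<open>(X, Y, Z)\<close>.\<close>

fun weight :: "int \<times> int \<times> int \<Rightarrow> real" where
  "weight (x, y, z) = 6 - 2 * real_of_int z / (real_of_int x * real_of_int y)"

fun excess :: "int \<times> int \<times> int \<Rightarrow> real" where
  "excess (x, y, z) = (weight (x, y, z) - lagrange_gap x - lagrange_gap y) / 2"

lemma markov_triple_real:
  assumes "markov_triple x y z"
  shows "real_of_int x ^ 2 + real_of_int y ^ 2 + real_of_int z ^ 2
    = 3 * real_of_int x * real_of_int y * real_of_int z"
  using arg_cong[OF assms[unfolded markov_triple_def], of real_of_int] by simp

lemma weight_children:
  assumes "t \<in> nonsingular_triples"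
  shows "weight (child False t) + weight (child True t) = weight t"
proof -
  obtain x y z where t: "t = (x, y, z)" by (cases t)
  with assms have pos: "0 < x" "0 < y" "0 < z" and m: "markov_triple x y z"
    by (auto simp: nonsingular_triples_def)
  have "weight (child False t) + weight (child True t) - weight t
      = 2 * (real_of_int x ^ 2 + real_of_int y ^ 2 + real_of_int z ^ 2
          - 3 * real_of_int x * real_of_int y * real_of_int z) / (real_of_int x * real_of_int y * real_of_int z)"
    using pos by (simp add: t divide_simps) (simp add: algebra_simps power2_eq_square)
  also have "\<dots> = 0" unfolding markov_triple_real[OF m] by simp
  finally show ?thesis by simp
qed

lemma excess_children:
  assumes "t \<in> nonsingular_triples"
  shows "excess t = lagrange_gap (greatest t) + excess (child False t) + excess (child True t)"
proof -
  obtain x y z where t: "t = (x, y, z)" by (cases t)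
  with assms have "0 < z" by (simp add: nonsingular_triples_def)
  then have "real (greatest t) = real_of_int z" by (simp add: t)
  then show ?thesis
    using weight_children[OF assms] by (simp add: t field_simps del: weight.simps)
qed

text \<open>Write \<open>A\<close> and \<open>B\<close> for the gaps of \<open>x\<close> and \<open>y\<close>. By the Markov equation
\<open>W (6 - W) = 4/x\<^sup>2 + 4/y\<^sup>2 = A (6 - A) + B (6 - B)\<close>, which factors as
\<open>(W - A - B) (6 - W - A) = B (W + A - B)\<close>. The second factor on the left is at least 2, and
monotonicity of \<open>r (6 - r)\<close> below 3 gives \<open>A \<le> W\<close> and \<open>B \<le> W\<close>, so \<open>0 \<le> W - A - B \<le> B W\<close>,
where \<open>B \<le> 1/y\<^sup>2\<close>.\<close>

lemma excess_bounds:
  assumes "(x, y, z) \<in> nonsingular_triples"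
  shows "0 \<le> excess (x, y, z)" "excess (x, y, z) \<le> weight (x, y, z) / y"
proof -
  have pos: "0 < x" "x < y" "y < z" and m: "markov_triple x y z"
    using assms by (auto simp: nonsingular_triples_def)
  define W where "W = weight (x, y, z)"
  define A where "A = lagrange_gap x"
  define B where "B = lagrange_gap y"
  have re: "real_of_int x ^ 2 + real_of_int y ^ 2 + real_of_int z ^ 2
      = 3 * real_of_int x * real_of_int y * real_of_int z"
    by (rule markov_triple_real[OF m])
  have A: "0 < A" "A \<le> 1" "A * (6 - A) = 4 / (real_of_int x)\<^sup>2"
    using lagrange_gap_bounds[of x] pos by (simp_all add: A_def)
  have B: "0 < B" "B \<le> 1" "B * (6 - B) = 4 / (real_of_int y)\<^sup>2" "B \<le> 1 / (real_of_int y)\<^sup>2"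
    using lagrange_gap_bounds[of y] pos by (simp_all add: B_def)
  have W: "W * (6 - W) = A * (6 - A) + B * (6 - B)"
  proof -
    have "W * (6 - W) - 4 / (real_of_int x)\<^sup>2 - 4 / (real_of_int y)\<^sup>2
        = - 4 * (real_of_int x ^ 2 + real_of_int y ^ 2 + real_of_int z ^ 2
          - 3 * real_of_int x * real_of_int y * real_of_int z) / (real_of_int x * real_of_int y)\<^sup>2"
      using pos by (simp add: W_def divide_simps) (simp add: algebra_simps power2_eq_square)
    also have "\<dots> = 0" unfolding re by simp
    finally show ?thesis unfolding A(3) B(3) by simp
  qed
  have "3 * x * y \<le> 2 * z" using nonsingular_neighbour_less[OF assms] pos by linarith
  then have "3 * real_of_int x * real_of_int y \<le> 2 * real_of_int z"
    using of_int_le_iff[of "3 * x * y" "2 * z", where 'a = real] by simp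
  then have "W \<le> 3" using pos by (simp add: W_def field_simps)
  have "0 < A * (6 - A)" "0 < B * (6 - B)" using A(1,2) B(1,2) by (intro mult_pos_pos; linarith)+
  \<comment> \<open>If \<open>A > W\<close> then \<open>A (6 - A) - W (6 - W) = (A - W) (6 - A - W)\<close> would be positive, but
    it is \<open>- B (6 - B)\<close>.\<close>
  have AW: "A \<le> W"
  proof (rule ccontr)
    assume "\<not> A \<le> W"
    then have "(A - W) * (6 - A - W) > 0" using A \<open>W \<le> 3\<close> by (intro mult_pos_pos) auto
    then show False using W \<open>0 < B * (6 - B)\<close> by (simp add: algebra_simps)
  qed
  have BW: "B \<le> W"
  proof (rule ccontr)
    assume "\<not> B \<le> W"
    then have "(B - W) * (6 - B - W) > 0" using B \<open>W \<le> 3\<close> by (intro mult_pos_pos) auto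
    then show False using W \<open>0 < A * (6 - A)\<close> by (simp add: algebra_simps)
  qed
  have key: "(W - A - B) * (6 - W - A) = B * (W + A - B)"
    using W by (simp add: algebra_simps)
  have D: "2 \<le> 6 - W - A" using \<open>W \<le> 3\<close> A by linarith
  have "0 \<le> (W - A - B) * (6 - W - A)" unfolding key using A B BW by simp
  then have nonneg: "0 \<le> W - A - B" using D by (simp add: zero_le_mult_iff)
  then show "0 \<le> excess (x, y, z)" by (simp add: W_def A_def B_def)
  have "(W - A - B) * 2 \<le> (W - A - B) * (6 - W - A)"
    using nonneg D by (intro mult_left_mono) auto
  also have "\<dots> \<le> B * (2 * W)" unfolding key using A B AW by (intro mult_left_mono) auto
  also have "\<dots> = (W * B) * 2" by simp
  finally have "W - A - B \<le> W * B" by (rule mult_right_le_imp_le) simp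
  also have "\<dots> \<le> W * (1 / y)"
  proof (intro mult_left_mono)
    have "real_of_int y * 1 \<le> real_of_int y * real_of_int y" using pos by (intro mult_left_mono) auto
    then have "1 / (real_of_int y)\<^sup>2 \<le> 1 / y"
      using pos by (simp add: power2_eq_square divide_simps)
    then show "B \<le> 1 / y" using B by linarith
    show "0 \<le> W" using A AW by linarith
  qed
  also have "\<dots> = W / y" by simp
  finally have "W - A - B \<le> W / y" .
  moreover have "(W - A - B) / 2 \<le> W - A - B" using nonneg by simp
  ultimately have "(W - A - B) / 2 \<le> W / y" by (rule order_trans[rotated])
  then show "excess (x, y, z) \<le> weight (x, y, z) / y" by (simp add: W_def A_def B_def)
qed

lemma sum_words_Suc:
  fixes f :: "bool list \<Rightarrow> real"
  shows "(\<Sum>w | length w = Suc n. f w) = (\<Sum>w | length w = n. f (False # w) + f (True # w))"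
proof -
  have "{w :: bool list. length w = Suc n}
      = Cons False ` {w. length w = n} \<union> Cons True ` {w. length w = n}"
    by (auto simp: length_Suc_conv)
  moreover have "finite {w :: bool list. length w = n}"
    using finite_lists_length_eq[of "UNIV :: bool set" n] by simp
  ultimately show ?thesis
    by (subst sum.distrib, simp only:)
      (subst sum.union_disjoint, auto simp: sum.reindex)
qed

lemma sum_weight_level: "(\<Sum>w | length w = n. weight (node w)) = 1"
  by (induction n) (simp_all add: sum_words_Suc weight_children[OF node_nonsingular])

lemma middle_grows: "node w = (x, y, z) \<Longrightarrow> int (length w) < y"
proof (induction w arbitrary: x y z)
  case (Cons b w)
  obtain p q r where t: "node w = (p, q, r)" by (cases "node w")
  have "q < r" using node_nonsingular[of w] t by (simp add: nonsingular_triples_def)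
  moreover have "y = r" using Cons.prems t by (cases b) auto
  ultimately show ?case using Cons.IH[OF t] by simp
qed simp

text \<open>The total weight of a level stays equal to 1, while the ratio of excess to weight is at most
\<open>1 / (n + 1)\<close> on level \<open>n\<close>.\<close>

lemma sum_excess_level_tendsto_0:
  "(\<lambda>n. \<Sum>w | length w = n. excess (node w)) \<longlonglongrightarrow> 0"
proof (rule tendsto_sandwich[of "\<lambda>_. 0"])
  have b: "0 \<le> excess (node w)" "excess (node w) \<le> weight (node w) / real (Suc (length w))" for w
  proof -
    obtain x y z where t: "node w = (x, y, z)" by (cases "node w")
    have N: "(x, y, z) \<in> nonsingular_triples" using node_nonsingular[of w] t by simp
    have y: "real (Suc (length w)) \<le> y" using middle_grows[OF t] by linarith
    note e = excess_bounds[OF N]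
    from e(1) show "0 \<le> excess (node w)" by (simp add: t del: excess.simps)
    have "0 \<le> weight (x, y, z) / y" using e by linarith
    then have "0 \<le> weight (x, y, z)"
      using y by (simp add: zero_le_divide_iff del: weight.simps)
    then have "weight (x, y, z) / y \<le> weight (x, y, z) / real (Suc (length w))"
      using y by (intro divide_left_mono) auto
    with e(2) show "excess (node w) \<le> weight (node w) / real (Suc (length w))"
      by (simp add: t del: excess.simps weight.simps)
  qed
  show "\<forall>\<^sub>F n in sequentially. 0 \<le> (\<Sum>w | length w = n. excess (node w))"
    using b(1) by (simp add: sum_nonneg)
  have "(\<Sum>w | length w = n. excess (node w)) \<le> 1 / real (Suc n)" for n
  proof -
    have "(\<Sum>w | length w = n. excess (node w)) \<le> (\<Sum>w | length w = n. weight (node w) / real (Suc n))"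
      using b(2) by (intro sum_mono) auto
    also have "\<dots> = 1 / real (Suc n)"
      by (simp only: sum_divide_distrib[symmetric] sum_weight_level)
    finally show ?thesis .
  qed
  then show "\<forall>\<^sub>F n in sequentially. (\<Sum>w | length w = n. excess (node w)) \<le> 1 / real (Suc n)"
    by simp
  show "(\<lambda>n. 1 / real (Suc n)) \<longlonglongrightarrow> 0" by (rule LIMSEQ_Suc[OF lim_1_over_n])
qed auto

lemma sum_gaps_below_level:
  "(\<Sum>w | length w < n. lagrange_gap (greatest (node w)))
     = excess (1, 2, 5) - (\<Sum>w | length w = n. excess (node w))"
proof (induction n)
  case (Suc n)
  have "{w :: bool list. length w < Suc n} = {w. length w < n} \<union> {w. length w = n}" by auto
  moreover have "finite {w :: bool list. length w < n}" "finite {w :: bool list. length w = n}"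
    using finite_lists_length_le[of "UNIV :: bool set" n] by (auto elim: rev_finite_subset)
  ultimately have "(\<Sum>w | length w < Suc n. lagrange_gap (greatest (node w)))
      = (\<Sum>w | length w < n. lagrange_gap (greatest (node w)))
        + (\<Sum>w | length w = n. lagrange_gap (greatest (node w)))"
    by (simp add: sum.union_disjoint disjoint_iff)
  then show ?case
    unfolding Suc.IH sum_words_Suc
    using excess_children[OF node_nonsingular] by (simp add: sum.distrib)
qed simp

lemma has_sum_nonneg_exhaustion:
  fixes f :: "'a \<Rightarrow> real"
  assumes nonneg: "\<And>x. x \<in> A \<Longrightarrow> 0 \<le> f x"
    and fin: "\<And>n. finite (E n)" and mono: "mono E" and exh: "(\<Union>n. E n) = A"
    and lim: "(\<lambda>n. sum f (E n)) \<longlonglongrightarrow> s"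
  shows "(f has_sum s) A"
proof -
  have sub: "E n \<subseteq> A" for n using exh by blast
  have "incseq (\<lambda>n. sum f (E n))"
    by (intro monoI sum_mono2 fin monoD[OF mono]) (use nonneg sub in blast)+
  then have le: "sum f (E n) \<le> s" for n using lim by (rule incseq_le)
  have bound: "sum f F \<le> s" if F: "finite F" "F \<subseteq> A" for F
  proof -
    have "\<exists>n. F \<subseteq> E n"
      using F
    proof (induction F rule: finite_induct)
      case (insert x F)
      then obtain m n where "F \<subseteq> E m" "x \<in> E n" using exh by blast
      then have "insert x F \<subseteq> E (max m n)"
        using monoD[OF mono, of m "max m n"] monoD[OF mono, of n "max m n"] by auto
      then show ?case by blast
    qed simp
    then obtain n where "F \<subseteq> E n" by blast
    then have "sum f F \<le> sum f (E n)" by (intro sum_mono2 fin) (use nonneg sub in blast)+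
    also note le
    finally show ?thesis .
  qed
  have summ: "f summable_on A"
    by (intro nonneg_bdd_above_summable_on bdd_aboveI2[where M = s]) (use nonneg bound in auto)
  have "infsum f A \<le> s" using summ bound by (rule infsum_le_finite_sums)
  moreover have "s \<le> infsum f A"
  proof (rule LIMSEQ_le_const2[OF lim])
    have "sum f (E n) \<le> infsum f A" for n
      by (rule finite_sum_le_infsum[OF summ fin sub]) (use nonneg in blast)
    then show "\<exists>N. \<forall>n\<ge>N. sum f (E n) \<le> infsum f A" by blast
  qed
  ultimately show ?thesis using has_sum_infsum[OF summ] by simp
qed

text \<open>With \<open>a = 3 - \<surd>5\<close> and \<open>b = 3 - \<surd>8\<close> the gaps of 1 and 2, the root \<open>(1, 2, 5)\<close> has weight 1 and
excess \<open>(1 - a - b) / 2\<close>. Adding the two singular triples gives \<open>(1 + a + b) / 2 = 4 - \<phi> - \<surd>2\<close>.\<close>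

lemma has_sum_gaps_sorted_triples:
  "((\<lambda>t. lagrange_gap (greatest t)) has_sum (4 - golden_ratio - sqrt 2)) sorted_markov_triples"
proof -
  let ?g = "\<lambda>t. lagrange_gap (greatest t)"
  have "((\<lambda>w. ?g (node w)) has_sum excess (1, 2, 5)) UNIV"
  proof (rule has_sum_nonneg_exhaustion[where E = "\<lambda>n. {w. length w < n}"])
    fix w
    obtain x y z where t: "node w = (x, y, z)" by (cases "node w")
    then have "1 \<le> z" using node_nonsingular[of w] by (simp add: nonsingular_triples_def)
    then show "0 \<le> ?g (node w)"
      using lagrange_gap_bounds(1)[of z] by (simp add: t)
  next
    show "finite {w :: bool list. length w < n}" for n
      using finite_lists_length_le[of "UNIV :: bool set" n] by (auto elim: rev_finite_subset)
    show "(\<lambda>n. \<Sum>w | length w < n. ?g (node w)) \<longlonglongrightarrow> excess (1, 2, 5)"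
      unfolding sum_gaps_below_level
      using tendsto_diff[OF tendsto_const sum_excess_level_tendsto_0, of "excess (1, 2, 5)"] by simp
  qed (auto intro: monoI)
  then have "(?g has_sum excess (1, 2, 5)) nonsingular_triples"
    using has_sum_reindex[OF inj_node, of ?g] range_node by (simp add: o_def del: excess.simps)
  then have "(?g has_sum sum ?g {(1, 1, 1), (1, 1, 2)} + excess (1, 2, 5)) sorted_markov_triples"
    unfolding sorted_markov_triples_eq
    by (intro has_sum_Un_disjoint has_sum_finite) (auto simp: nonsingular_triples_def)
  moreover have "sqrt 8 = 2 * sqrt 2"
    using real_sqrt_mult[of 4 2] by simp
  then have "sum ?g {(1, 1, 1), (1, 1, 2)} + excess (1, 2, 5) = 4 - golden_ratio - sqrt 2"
    by (simp add: lagrange_gap_def golden_ratio_def field_simps)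
  ultimately show ?thesis by simp
qed

section \<open>The equivalence\<close>

lemma sums_enumerate_iff_has_sum:
  fixes f :: "nat \<Rightarrow> real"
  assumes "infinite A" "\<And>n. n \<in> A \<Longrightarrow> 0 \<le> f n"
  shows "(\<lambda>n. f (enumerate A n)) sums s \<longleftrightarrow> (f has_sum s) A"
proof -
  have "(\<lambda>n. f (enumerate A n)) sums s \<longleftrightarrow> ((\<lambda>n. f (enumerate A n)) has_sum s) UNIV"
    using sums_nonneg_imp_has_sum[of "\<lambda>n. f (enumerate A n)" s]
      has_sum_imp_sums[of "\<lambda>n. f (enumerate A n)" s]
      assms(2)[OF enumerate_in_set[OF assms(1)]] by blast
  also have "\<dots> \<longleftrightarrow> (f has_sum s) A"
    by (rule has_sum_reindex_bij_betw) (rule bij_enumerate[OF assms(1)])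
  finally show ?thesis .
qed

text \<open>Choose one preimage for each value. If some point of \<open>A\<close> is left over, its positive term makes
the sum over \<open>A\<close> strictly larger than the sum over the image.\<close>

lemma inj_on_iff_has_sum_image:
  fixes f :: "'b \<Rightarrow> real"
  assumes total: "((\<lambda>x. f (g x)) has_sum s) A" and pos: "\<And>x. x \<in> A \<Longrightarrow> 0 < f (g x)"
  shows "inj_on g A \<longleftrightarrow> (f has_sum s) (g ` A)"
proof
  assume "inj_on g A"
  then show "(f has_sum s) (g ` A)" using total by (simp add: has_sum_reindex o_def)
next
  assume image: "(f has_sum s) (g ` A)"
  define R where "R = inv_into A g ` g ` A"
  have R: "R \<subseteq> A" by (auto simp: R_def inv_into_into)
  have injR: "inj_on g R" by (auto simp: R_def inj_on_def f_inv_into_f)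
  have imR: "g ` R = g ` A" by (force simp: R_def f_inv_into_f image_image)
  have partial: "((\<lambda>x. f (g x)) has_sum s) R"
    using image has_sum_reindex[OF injR, of f] by (simp add: imR o_def)
  have "A - R = {}"
  proof (rule ccontr)
    assume "A - R \<noteq> {}"
    then obtain a where a: "a \<in> A" "a \<notin> R" by blast
    have "((\<lambda>x. f (g x)) has_sum (f (g a) + s)) (insert a R)"
      using has_sum_insert[OF a(2) partial] .
    then have "f (g a) + s \<le> s"
      using total by (rule has_sum_mono2) (use a R pos in \<open>auto intro: less_imp_le\<close>)
    then show False using pos[OF a(1)] by simp
  qed
  then have "R = A" using R by blast
  with injR show "inj_on g A" by simp
qed

theorem theorem1p1:
  shows "markov_uniqueness_conjecture \<longleftrightarrow>
    (\<lambda>n. 3 - lagrange_number (Suc n)) sums (4 - golden_ratio - sqrt 2)"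
proof -
  let ?g = "\<lambda>m :: nat. lagrange_gap m"
  have pos: "0 < ?g m" if "m \<in> markov_numbers" for m
    using that lagrange_gap_bounds(1)[of m] by (simp add: markov_numbers_def)
  have "markov_uniqueness_conjecture \<longleftrightarrow> inj_on greatest sorted_markov_triples"
    by (rule markov_uniqueness_conjecture_iff_inj)
  also have "\<dots> \<longleftrightarrow> (?g has_sum (4 - golden_ratio - sqrt 2)) markov_numbers"
    unfolding greatest_image[symmetric]
    by (rule inj_on_iff_has_sum_image[where f = ?g, OF has_sum_gaps_sorted_triples])
      (use pos greatest_image in blast)
  also have "\<dots> \<longleftrightarrow> (\<lambda>n. ?g (enumerate markov_numbers n)) sums (4 - golden_ratio - sqrt 2)"
    by (rule sums_enumerate_iff_has_sum[symmetric])
      (use infinite_markov_numbers pos in \<open>auto intro: less_imp_le\<close>)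
  also have "(\<lambda>n. ?g (enumerate markov_numbers n)) = (\<lambda>n. 3 - lagrange_number (Suc n))"
    by (simp add: lagrange_gap_def lagrange_number_def markov_number_def)
  finally show ?thesis .
qed

end
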